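(* Let $n>3$ and let $A=LL^*\in M_n(\mathbb{C})$, where $L=(L_{ij})$ is lower triangular. Let $$m:=\max\{|L_{ij}| : 2\le i,j\le n\}\quad\text{and}\quad a:=\frac{\epsilon_n}{m},$$ where $$\epsilon_n=\min\left\{\frac{\alpha}{\alpha_0^{\,n-1}}\sqrt{\frac{2}{3\,n!\,M_n}},\,1\right\},\qquad \alpha=\prod_{i=1}^n|L_{i1}|,\qquad \alpha_0=\max_{1\le i\le n}|L_{i1}|.$$ If each entry in the first column of $A$ is not zero, then $$[A]:=\{L\operatorname{diag}(1,\lambda_2^2,\dots,\lambda_n^2)L^* : 0<\lambda_2,\dots,\lambda_n\le a\}$$ is an infinite class of positive semi-definite matrices satisfying the permanent dominant conjecture; that is, $\bar d^G_\chi(X)\le\operatorname{per}(X)$ for every $X\in[A]$, every subgroup $G\le S_n$ and every irreducible character $\chi$ of $G$.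
   Context: Characters are characters of finite-dimensional complex representations. For $G\le S_n$, a character $\chi$ of $G$ and $X=(X_{ij})\in M_n(\mathbb{C})$, put $d^G_\chi(X)=\sum_{g\in G}\chi(g)\prod_{i=1}^n X_{i\,g(i)}$ and $\bar d^G_\chi(X)=\frac{1}{\chi(e)}d^G_\chi(X)$, where $e$ is the identity; $\operatorname{per}(X)=\sum_{\sigma\in S_n}\prod_{i=1}^nX_{i\sigma(i)}$. For $n>3$, $$M_n= \begin{cases} n^n-(n-1)^n-n!-n^{\frac{n-4}{2}}\left(\frac{n-2}{2}\right)^{\frac{n+2}{2}}\left(\frac{n+4}{2}\right)-1, & n \text{ even},\\ n^n-(n-1)^n-n!-n^{\frac{n-5}{2}}\left(\frac{n-1}{2}\right)^{\frac{n+1}{2}}\left(\frac{n+3}{2}\right)-1, & n \text{ odd}. \end{cases}$$ *)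

theory Defs
  imports Complex_Main "HOL-Algebra.Sym_Groups" "Jordan_Normal_Form.Schur_Decomposition"
begin

(* Matrices of Jordan_Normal_Form are indexed from 0, whereas sym_group n acts on {1..n}:
   ent X i j is the entry X_ij in the usual numbering 1 \<le> i, j \<le> n. *)
definition ent :: "complex mat \<Rightarrow> nat \<Rightarrow> nat \<Rightarrow> complex" where
  "ent X i j = X $$ (i - 1, j - 1)"

definition lower_triangular :: "nat \<Rightarrow> complex mat \<Rightarrow> bool" where
  "lower_triangular n L \<longleftrightarrow> (\<forall>i\<in>{1..n}. \<forall>j\<in>{1..n}. i < j \<longrightarrow> ent L i j = 0)"

definition pos_semidef :: "nat \<Rightarrow> complex mat \<Rightarrow> bool" where
  "pos_semidef n X \<longleftrightarrow> X \<in> carrier_mat n n \<and> mat_adjoint X = X \<and>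
     (\<forall>v\<in>carrier_vec n. (X *\<^sub>v v) \<bullet>c v \<in> \<real> \<and> 0 \<le> Re ((X *\<^sub>v v) \<bullet>c v))"

definition per :: "nat \<Rightarrow> complex mat \<Rightarrow> complex" where
  "per n X = (\<Sum>\<sigma>\<in>carrier (sym_group n). \<Prod>i\<in>{1..n}. ent X i (\<sigma> i))"

definition gen_matrix_fun ::
  "nat \<Rightarrow> (nat \<Rightarrow> nat) set \<Rightarrow> ((nat \<Rightarrow> nat) \<Rightarrow> complex) \<Rightarrow> complex mat \<Rightarrow> complex" where
  "gen_matrix_fun n G \<chi> X = (\<Sum>g\<in>G. \<chi> g * (\<Prod>i\<in>{1..n}. ent X i (g i)))"

definition norm_gen_matrix_fun ::
  "nat \<Rightarrow> (nat \<Rightarrow> nat) set \<Rightarrow> ((nat \<Rightarrow> nat) \<Rightarrow> complex) \<Rightarrow> complex mat \<Rightarrow> complex" where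
  "norm_gen_matrix_fun n G \<chi> X = gen_matrix_fun n G \<chi> X / \<chi> \<one>\<^bsub>sym_group n\<^esub>"

definition mat_trace :: "complex mat \<Rightarrow> complex" where
  "mat_trace A = (\<Sum>i<dim_row A. A $$ (i, i))"

definition representation ::
  "nat \<Rightarrow> (nat \<Rightarrow> nat) set \<Rightarrow> nat \<Rightarrow> ((nat \<Rightarrow> nat) \<Rightarrow> complex mat) \<Rightarrow> bool" where
  "representation n G d \<rho> \<longleftrightarrow>
     \<rho> \<in> hom (sym_group n \<lparr>carrier := G\<rparr>) (units_of (ring_mat TYPE(complex) d ()))"

definition irreducible_representation ::
  "nat \<Rightarrow> (nat \<Rightarrow> nat) set \<Rightarrow> nat \<Rightarrow> ((nat \<Rightarrow> nat) \<Rightarrow> complex mat) \<Rightarrow> bool" where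
  "irreducible_representation n G d \<rho> \<longleftrightarrow> representation n G d \<rho> \<and> d > 0 \<and>
     (\<forall>W. VectorSpace.subspace class_ring W (module_vec TYPE(complex) d) \<and>
          (\<forall>g\<in>G. \<forall>w\<in>W. \<rho> g *\<^sub>v w \<in> W) \<longrightarrow> W = {0\<^sub>v d} \<or> W = carrier_vec d)"

definition irreducible_character ::
  "nat \<Rightarrow> (nat \<Rightarrow> nat) set \<Rightarrow> ((nat \<Rightarrow> nat) \<Rightarrow> complex) \<Rightarrow> bool" where
  "irreducible_character n G \<chi> \<longleftrightarrow>
     (\<exists>d \<rho>. irreducible_representation n G d \<rho> \<and> (\<forall>g\<in>G. \<chi> g = mat_trace (\<rho> g)))"

(* The inequality compares real numbers, so it includes the claim that both sides are real. *)
definition satisfies_permanent_dominance :: "nat \<Rightarrow> complex mat \<Rightarrow> bool" where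
  "satisfies_permanent_dominance n X \<longleftrightarrow>
     (\<forall>G \<chi>. subgroup G (sym_group n) \<and> irreducible_character n G \<chi> \<longrightarrow>
        norm_gen_matrix_fun n G \<chi> X \<in> \<real> \<and> per n X \<in> \<real> \<and>
        Re (norm_gen_matrix_fun n G \<chi> X) \<le> Re (per n X))"

(* Only meant for n > 3; all the natural number subtractions and divisions in the exponents
   are then exact. *)
definition M_const :: "nat \<Rightarrow> real" where
  "M_const n =
     (if even n then
        real n ^ n - (real n - 1) ^ n - fact n
          - real n ^ ((n - 4) div 2) * ((real n - 2) / 2) ^ ((n + 2) div 2)
              * ((real n + 4) / 2) - 1
      else
        real n ^ n - (real n - 1) ^ n - fact n
          - real n ^ ((n - 5) div 2) * ((real n - 1) / 2) ^ ((n + 1) div 2)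
              * ((real n + 3) / 2) - 1)"

definition eps_const :: "nat \<Rightarrow> real \<Rightarrow> real \<Rightarrow> real" where
  "eps_const n \<alpha> \<alpha>\<^sub>0 = min (\<alpha> / \<alpha>\<^sub>0 ^ (n - 1) * sqrt (2 / (3 * fact n * M_const n))) 1"

(* The index k of mat_diag starts at 0, so position k carries lam (k + 1). *)
definition matrix_class :: "nat \<Rightarrow> complex mat \<Rightarrow> real \<Rightarrow> complex mat set" where
  "matrix_class n L a =
     {L * mat_diag n (\<lambda>k. if k = 0 then 1 else complex_of_real ((lam (k + 1))\<^sup>2)) * mat_adjoint L
        | lam. \<forall>j\<in>{2..n}. 0 < lam j \<and> lam j \<le> a}"

end

(* Every matrix of the class is a small perturbation of the rank one
   matrix v v*, where v is the first column of L and has no zero entry: the choice of a bounds the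
   other columns so strongly that each diagonal product prod_i X_{i g(i)} is within s/4 of
   s = prod_i |v_i|^2. Hence per(X) >= (3/4) n! s. For a nontrivial irreducible character the values
   sum to zero, so s may be subtracted from every diagonal product, leaving at most n! s/4; for the
   trivial character of a proper subgroup, Lagrange leaves at most (n!/2)(5/4)s; and the trivial
   character of S_n gives the permanent itself. *)

theory Submission
  imports Defs "HOL-Algebra.Multiplicative_Group"
begin

section \<open>Traces of matrices of finite order\<close>

lemma mat_trace_mult_comm:
  assumes "A \<in> carrier_mat n k" "B \<in> carrier_mat k n"
  shows "mat_trace (A * B) = mat_trace (B * A)"
proof -
  have "mat_trace (A * B) = (\<Sum>i<n. \<Sum>j<k. A $$ (i, j) * B $$ (j, i))"
    using assms by (auto simp: mat_trace_def scalar_prod_def atLeast0LessThan intro!: sum.cong)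
  also have "\<dots> = (\<Sum>j<k. \<Sum>i<n. B $$ (j, i) * A $$ (i, j))"
    by (subst sum.swap) (simp add: mult.commute)
  also have "\<dots> = mat_trace (B * A)"
    using assms by (auto simp: mat_trace_def scalar_prod_def atLeast0LessThan intro!: sum.cong)
  finally show ?thesis .
qed

lemma mat_trace_similar:
  assumes "similar_mat_wit A B P Q"
  shows "mat_trace A = mat_trace B"
proof -
  obtain n where c: "A \<in> carrier_mat n n" "B \<in> carrier_mat n n" "P \<in> carrier_mat n n"
      "Q \<in> carrier_mat n n" and eq: "A = P * B * Q" "Q * P = 1\<^sub>m n"
    using similar_mat_witD[OF refl assms] by blast
  have "mat_trace A = mat_trace (Q * (P * B))"
    unfolding eq(1) using c by (intro mat_trace_mult_comm) auto
  also have "Q * (P * B) = B"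
    using c eq(2) assoc_mult_mat[of Q n n P n B n] by simp
  finally show ?thesis .
qed

text \<open>In the sum for entry (i, j) a term with k < i vanishes through \<open>A\<close> and a
  term with k > j through \<open>B\<close>. Below the diagonal this covers all k; on it only k = i
  survives.\<close>

lemma upper_triangular_mult:
  fixes A B :: "'a :: semiring_1 mat"
  assumes A: "A \<in> carrier_mat n n" and B: "B \<in> carrier_mat n n"
    and "upper_triangular A" "upper_triangular B"
  shows "upper_triangular (A * B)"
    and "i < n \<Longrightarrow> (A * B) $$ (i, i) = A $$ (i, i) * B $$ (i, i)"
proof -
  have zero: "A $$ (i, k) = 0" if "k < i" "i < n" for i k
    using assms that by auto
  have zero': "B $$ (k, j) = 0" if "j < k" "k < n" for j k
    using assms that by auto
  show "upper_triangular (A * B)"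
  proof (rule upper_triangularI)
    fix i j assume ij: "j < i" "i < dim_row (A * B)"
    have "(A * B) $$ (i, j) = (\<Sum>k<n. A $$ (i, k) * B $$ (k, j))"
      using A B ij by (auto simp: scalar_prod_def atLeast0LessThan)
    also have "\<dots> = 0"
    proof (rule sum.neutral, safe)
      fix k assume "k < n"
      then show "A $$ (i, k) * B $$ (k, j) = 0"
        using zero[of k i] zero'[of j k] A ij by (cases "k < i") auto
    qed
    finally show "(A * B) $$ (i, j) = 0" .
  qed
  assume i: "i < n"
  have "(A * B) $$ (i, i) = (\<Sum>k<n. A $$ (i, k) * B $$ (k, i))"
    using A B i by (auto simp: scalar_prod_def atLeast0LessThan)
  also have "\<dots> = (\<Sum>k<n. if k = i then A $$ (i, i) * B $$ (i, i) else 0)"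
  proof (rule sum.cong)
    fix k assume "k \<in> {..<n}"
    then show "A $$ (i, k) * B $$ (k, i) = (if k = i then A $$ (i, i) * B $$ (i, i) else 0)"
      using zero[of k i] zero'[of i k] i by (cases k i rule: linorder_cases) auto
  qed simp
  finally show "(A * B) $$ (i, i) = A $$ (i, i) * B $$ (i, i)"
    using i by simp
qed

lemma upper_triangular_pow_mat:
  fixes A :: "'a :: semiring_1 mat"
  assumes A: "A \<in> carrier_mat n n" and "upper_triangular A"
  shows "upper_triangular (A ^\<^sub>m k) \<and> (\<forall>i<n. (A ^\<^sub>m k) $$ (i, i) = (A $$ (i, i)) ^ k)"
proof (induction k)
  case 0
  then show ?case using A by auto
next
  case (Suc k)
  have "A ^\<^sub>m k \<in> carrier_mat n n"
    using A by auto
  then show ?case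
    using Suc assms upper_triangular_mult[of "A ^\<^sub>m k" n A] by (simp add: power_commutes)
qed

text \<open>The eigenvalues are roots of unity, so their inverses are their conjugates.\<close>

lemma mat_trace_finite_order:
  assumes A: "A \<in> carrier_mat n n" and N: "N > 0" and "A ^\<^sub>m N = 1\<^sub>m n"
  shows "cmod (mat_trace A) \<le> n" and "mat_trace (A ^\<^sub>m (N - 1)) = cnj (mat_trace A)"
proof -
  obtain as where as: "char_poly A = (\<Prod>a\<leftarrow>as. [:- a, 1:])"
    using char_poly_factorized[OF A] by blast
  obtain T P Q where "schur_decomposition A as = (T, P, Q)"
    by (cases "schur_decomposition A as")
  from schur_decomposition[OF A as this]
  have sim: "similar_mat_wit A T P Q" and upper: "upper_triangular T"
    by auto
  have T: "T \<in> carrier_mat n n"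
    using similar_mat_witD2(5)[OF A sim] .
  \<comment> \<open>The same \<open>P\<close> and \<open>Q\<close> triangularize all powers of
    \<open>A\<close>, so every trace below is read off the diagonal of \<open>T\<close>.\<close>
  have sim_pow: "similar_mat_wit (A ^\<^sub>m k) (T ^\<^sub>m k) P Q" for k
    by (rule similar_mat_wit_pow[OF sim])
  have "T ^\<^sub>m N = 1\<^sub>m n"
    using similar_mat_wit_pow_id[OF similar_mat_wit_sym[OF sim], of N] similar_mat_witD2(1,2,4-7)[OF A sim]
    by (simp add: assms(3))
  then have root: "(T $$ (i, i)) ^ N = 1" if "i < n" for i
    using upper_triangular_pow_mat[OF T upper, of N] that by auto
  have norm: "cmod (T $$ (i, i)) = 1" if "i < n" for i
    using root[OF that] N by (metis norm_one norm_power norm_ge_zero power_eq_1_iff neq0_conv)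
  have trA: "mat_trace A = (\<Sum>i<n. T $$ (i, i))"
    unfolding mat_trace_similar[OF sim] using T by (simp add: mat_trace_def)
  then show "cmod (mat_trace A) \<le> n"
    using sum_norm_le[of "{..<n}" "\<lambda>i. T $$ (i, i)" "\<lambda>_. 1"] norm by auto
  \<comment> \<open>Both sides are inverses of the same number: one because its \<open>N\<close>-th
    power is 1, the other because its modulus is 1.\<close>
  have cnj: "(T $$ (i, i)) ^ (N - 1) = cnj (T $$ (i, i))" if "i < n" for i
  proof -
    have "T $$ (i, i) * (T $$ (i, i)) ^ (N - 1) = 1"
      using root[OF that] N by (metis power_minus_mult mult.commute)
    moreover have "T $$ (i, i) * cnj (T $$ (i, i)) = 1"
      using norm[OF that] by (simp add: complex_norm_square[symmetric])
    ultimately show ?thesis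
      by (metis mult_cancel_left mult_zero_left zero_neq_one)
  qed
  have "mat_trace (A ^\<^sub>m (N - 1)) = (\<Sum>i<n. (T $$ (i, i)) ^ (N - 1))"
    unfolding mat_trace_similar[OF sim_pow] using T upper_triangular_pow_mat[OF T upper]
    by (simp add: mat_trace_def)
  also have "\<dots> = cnj (mat_trace A)"
    using cnj by (simp add: trA)
  finally show "mat_trace (A ^\<^sub>m (N - 1)) = cnj (mat_trace A)" .
qed

section \<open>Characters of finite groups\<close>

text \<open>Unpacks a homomorphism into the unit group of the matrix ring as plain matrix
  identities. The group is arbitrary so that \<open>sym_group n\<close> with its carrier replaced by
  a subgroup can be inserted.\<close>

lemma representation_matrices:
  assumes H: "group H" and \<rho>: "\<rho> \<in> hom H (units_of (ring_mat TYPE(complex) d ()))"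
  shows "g \<in> carrier H \<Longrightarrow> \<rho> g \<in> carrier_mat d d"
    and "g \<in> carrier H \<Longrightarrow> h \<in> carrier H \<Longrightarrow> \<rho> (g \<otimes>\<^bsub>H\<^esub> h) = \<rho> g * \<rho> h"
    and "\<rho> \<one>\<^bsub>H\<^esub> = 1\<^sub>m d"
    and "g \<in> carrier H \<Longrightarrow> \<rho> (g [^]\<^bsub>H\<^esub> (k :: nat)) = \<rho> g ^\<^sub>m k"
proof -
  let ?R = "ring_mat TYPE(complex) d ()"
  interpret R: ring ?R by (rule ring_mat)
  interpret H: group H by fact
  show carr: "\<rho> g \<in> carrier_mat d d" if "g \<in> carrier H" for g
    using hom_in_carrier[OF \<rho> that] R.Units_closed by (auto simp: units_of_def ring_mat_simps)
  show mult: "\<rho> (g \<otimes>\<^bsub>H\<^esub> h) = \<rho> g * \<rho> h" if "g \<in> carrier H" "h \<in> carrier H" for g h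
    using hom_mult[OF \<rho> that] by (simp add: units_of_def ring_mat_simps)
  show one: "\<rho> \<one>\<^bsub>H\<^esub> = 1\<^sub>m d"
    using hom_one[OF \<rho> H R.units_group] by (simp add: units_of_def ring_mat_simps)
  show "\<rho> (g [^]\<^bsub>H\<^esub> (k :: nat)) = \<rho> g ^\<^sub>m k" if "g \<in> carrier H"
  proof (induction k)
    case 0
    then show ?case using carr[OF that] one by simp
  next
    case (Suc k)
    then show ?case using mult[of "g [^]\<^bsub>H\<^esub> k" g] that by simp
  qed
qed

text \<open>By Lagrange the matrix of g has a power equal to the identity, with the group order as
  exponent. The inverse of g is the power with exponent one less, so
  \<open>mat_trace_finite_order\<close> gives both claims.\<close>

lemma character_values:
  assumes H: "group H" and fin: "finite (carrier H)"
    and \<rho>: "\<rho> \<in> hom H (units_of (ring_mat TYPE(complex) d ()))" and g: "g \<in> carrier H"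
  shows "cmod (mat_trace (\<rho> g)) \<le> d"
    and "mat_trace (\<rho> (inv\<^bsub>H\<^esub> g)) = cnj (mat_trace (\<rho> g))"
proof -
  interpret H: group H by fact
  note rep = representation_matrices[OF H \<rho>]
  have pos: "Coset.order H > 0"
    using fin H.order_gt_0_iff_finite by simp
  have ord: "g [^]\<^bsub>H\<^esub> Coset.order H = \<one>\<^bsub>H\<^esub>"
    using H.pow_order_eq_1[OF g] .
  then have "\<rho> g ^\<^sub>m Coset.order H = 1\<^sub>m d"
    using rep(3) rep(4)[OF g, of "Coset.order H"] by simp
  note trace = mat_trace_finite_order[OF rep(1)[OF g] pos this]
  show "cmod (mat_trace (\<rho> g)) \<le> d" by (rule trace)
  have "g [^]\<^bsub>H\<^esub> (Coset.order H - 1) \<otimes>\<^bsub>H\<^esub> g = \<one>\<^bsub>H\<^esub>"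
    using ord pos by (metis H.nat_pow_Suc Suc_pred' )
  then have "inv\<^bsub>H\<^esub> g = g [^]\<^bsub>H\<^esub> (Coset.order H - 1)"
    using g by (simp add: H.inv_equality)
  then show "mat_trace (\<rho> (inv\<^bsub>H\<^esub> g)) = cnj (mat_trace (\<rho> g))"
    using rep(4)[OF g] trace(2) by simp
qed

section \<open>Averaging over the group and the sum of an irreducible character\<close>

lemma mult_mat_vec_unit_vec:
  fixes A :: "'a :: semiring_1 mat"
  assumes "A \<in> carrier_mat n k" "j < k"
  shows "A *\<^sub>v unit_vec k j = col A j"
  using assms by (intro eq_vecI) auto

text \<open>Irreducibility quantifies over \<open>VectorSpace.subspace\<close>, so the range of the
  averaging operator has to be presented in this form before it can be used as an invariant
  subspace.\<close>

lemma subspace_mat_range: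
  fixes P :: "complex mat"
  assumes P: "P \<in> carrier_mat d k"
  shows "VectorSpace.subspace class_ring ((*\<^sub>v) P ` carrier_vec k) (module_vec TYPE(complex) d)"
proof (unfold VectorSpace.subspace_def, intro conjI vec_vs submodule.intro)
  show "Module.module class_ring (module_vec TYPE(complex) d)" by (rule vec_module)
  show "(*\<^sub>v) P ` carrier_vec k \<subseteq> carrier (module_vec TYPE(complex) d)"
    using P by (auto simp: module_vec_simps)
  show "\<zero>\<^bsub>module_vec TYPE(complex) d\<^esub> \<in> (*\<^sub>v) P ` carrier_vec k"
    using P by (auto simp: module_vec_simps intro!: image_eqI[of _ _ "0\<^sub>v k"])
  show "v \<oplus>\<^bsub>module_vec TYPE(complex) d\<^esub> w \<in> (*\<^sub>v) P ` carrier_vec k"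
    if vw: "v \<in> (*\<^sub>v) P ` carrier_vec k" "w \<in> (*\<^sub>v) P ` carrier_vec k" for v w
  proof -
    obtain v' w' where *: "v' \<in> carrier_vec k" "w' \<in> carrier_vec k" "v = P *\<^sub>v v'" "w = P *\<^sub>v w'"
      using vw by blast
    then have "v + w = P *\<^sub>v (v' + w')"
      using P by (simp add: mult_add_distrib_mat_vec)
    then show ?thesis using * by (auto simp: module_vec_simps)
  qed
  show "c \<odot>\<^bsub>module_vec TYPE(complex) d\<^esub> v \<in> (*\<^sub>v) P ` carrier_vec k"
    if v: "v \<in> (*\<^sub>v) P ` carrier_vec k" for c v
  proof -
    obtain v' where *: "v' \<in> carrier_vec k" "v = P *\<^sub>v v'"
      using v by blast
    then have "c \<cdot>\<^sub>v v = P *\<^sub>v (c \<cdot>\<^sub>v v')"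
      using P by (simp add: mult_mat_vec)
    then show ?thesis using * by (auto simp: module_vec_simps)
  qed
qed

text \<open>The range of the averaging operator consists of fixed vectors, hence is invariant; by
  irreducibility it is trivial (the trace of the operator vanishes) or everything (the
  representation is trivial).\<close>

lemma irreducible_character_sum:
  assumes G: "subgroup G (sym_group n)" and irr: "irreducible_representation n G d \<rho>"
  shows "(\<Sum>g\<in>G. mat_trace (\<rho> g)) = 0 \<or> (\<forall>g\<in>G. \<rho> g = 1\<^sub>m d)"
proof -
  let ?H = "sym_group n\<lparr>carrier := G\<rparr>"
  have H: "group ?H"
    using subgroup.subgroup_is_group[OF G sym_group_is_group] .
  have "\<rho> \<in> hom ?H (units_of (ring_mat TYPE(complex) d ()))"
    using irr by (simp add: irreducible_representation_def representation_def)
  note rep = representation_matrices[OF H this, simplified]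
  interpret H: group ?H by (rule H)
  \<comment> \<open>\<open>P\<close> is the sum of all \<rho>(g), the averaging operator without the
    factor 1/|G|. Multiplication by \<rho>(h) only permutes its summands.\<close>
  define P where "P = mat d d (\<lambda>(i, j). \<Sum>g\<in>G. \<rho> g $$ (i, j))"
  have P: "P \<in> carrier_mat d d" by (simp add: P_def)
  have fixed: "\<rho> h * P = P" if h: "h \<in> G" for h
  proof (rule eq_matI)
    fix i j assume ij: "i < dim_row P" "j < dim_col P"
    then have ij: "i < d" "j < d" using P by auto
    have "(\<rho> h * P) $$ (i, j) = (\<Sum>k<d. \<rho> h $$ (i, k) * (\<Sum>g\<in>G. \<rho> g $$ (k, j)))"
      using rep(1)[OF h] ij by (auto simp: scalar_prod_def P_def atLeast0LessThan)
    also have "\<dots> = (\<Sum>g\<in>G. \<Sum>k<d. \<rho> h $$ (i, k) * \<rho> g $$ (k, j))"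
      by (subst sum.swap) (simp add: sum_distrib_left)
    also have "\<dots> = (\<Sum>g\<in>G. \<rho> (h \<otimes>\<^bsub>sym_group n\<^esub> g) $$ (i, j))"
    proof (rule sum.cong)
      fix g assume g: "g \<in> G"
      show "(\<Sum>k<d. \<rho> h $$ (i, k) * \<rho> g $$ (k, j)) = \<rho> (h \<otimes>\<^bsub>sym_group n\<^esub> g) $$ (i, j)"
        using rep(1)[OF h] rep(1)[OF g] ij
        by (simp add: rep(2)[OF h g] scalar_prod_def atLeast0LessThan)
    qed simp
    also have "\<dots> = (\<Sum>g\<in>G. \<rho> g $$ (i, j))"
    proof (rule sum.reindex_bij_betw)
      show "bij_betw ((\<otimes>\<^bsub>sym_group n\<^esub>) h) G G"
        using H.inj_on_cmult[of h] H.surj_const_mult[of h] h by (simp add: bij_betw_def)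
    qed
    finally show "(\<rho> h * P) $$ (i, j) = P $$ (i, j)"
      using ij by (simp add: P_def)
  qed (use P rep(1)[OF h] in auto)
  have fixed': "\<rho> h *\<^sub>v w = w" if h: "h \<in> G" and w: "w \<in> (*\<^sub>v) P ` carrier_vec d" for h w
  proof -
    obtain v where v: "v \<in> carrier_vec d" "w = P *\<^sub>v v" using w by blast
    then show ?thesis
      using assoc_mult_mat_vec[OF rep(1)[OF h] P, of v] fixed[OF h] by simp
  qed
  have "(*\<^sub>v) P ` carrier_vec d = {0\<^sub>v d} \<or> (*\<^sub>v) P ` carrier_vec d = carrier_vec d"
    using irr subspace_mat_range[OF P] fixed'
    unfolding irreducible_representation_def by blast
  then show ?thesis
  proof
    \<comment> \<open>Zero range makes all diagonal entries of \<open>P\<close> vanish, and their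
      sum is the sum of the traces.\<close>
    assume zero: "(*\<^sub>v) P ` carrier_vec d = {0\<^sub>v d}"
    have "P $$ (i, i) = 0" if "i < d" for i
    proof -
      have "P *\<^sub>v unit_vec d i \<in> {0\<^sub>v d}"
        using zero by (metis imageI unit_vec_carrier)
      then have "col P i = 0\<^sub>v d"
        using mult_mat_vec_unit_vec[OF P that] by simp
      then show ?thesis
        using P that by (metis carrier_matD index_col index_zero_vec(1))
    qed
    moreover have "(\<Sum>g\<in>G. mat_trace (\<rho> g)) = (\<Sum>g\<in>G. \<Sum>i<d. \<rho> g $$ (i, i))"
      using rep(1) by (intro sum.cong) (auto simp: mat_trace_def)
    ultimately show ?thesis
      by (subst (asm) sum.swap) (simp add: P_def)
  next
    \<comment> \<open>Now every vector is in the range, hence fixed by each \<rho>(g); the unit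
      vectors then show that \<rho>(g) has the columns of the identity.\<close>
    assume all: "(*\<^sub>v) P ` carrier_vec d = carrier_vec d"
    have "\<rho> g = 1\<^sub>m d" if g: "g \<in> G" for g
    proof (rule eq_matI)
      fix i j assume "i < dim_row (1\<^sub>m d :: complex mat)" "j < dim_col (1\<^sub>m d :: complex mat)"
      then have ij: "i < d" "j < d" by auto
      have "col (\<rho> g) j = unit_vec d j"
        using fixed'[OF g, unfolded all, of "unit_vec d j"]
          mult_mat_vec_unit_vec[OF rep(1)[OF g] ij(2)] by simp
      then have "\<rho> g $$ (i, j) = unit_vec d j $ i"
        using rep(1)[OF g] ij by (metis carrier_matD index_col)
      then show "\<rho> g $$ (i, j) = 1\<^sub>m d $$ (i, j)"
        using ij by (auto simp: unit_vec_def)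
    qed (use rep(1)[OF g] in auto)
    then show ?thesis by blast
  qed
qed

section \<open>Numerical estimates\<close>

text \<open>Division by \<open>K\<close> moves all factors into the unit disc, where the difference
  of two products is at most the sum of the differences of the factors. Scaling back costs
  \<open>K ^ card I\<close>, of which one factor cancels.\<close>

lemma norm_prod_diff_le:
  fixes z w :: "'i \<Rightarrow> complex" and K y :: real
  assumes K: "K > 0" and z: "\<And>i. i \<in> I \<Longrightarrow> cmod (z i) \<le> K" and w: "\<And>i. i \<in> I \<Longrightarrow> cmod (w i) \<le> K"
    and y: "\<And>i. i \<in> I \<Longrightarrow> cmod (z i - w i) \<le> y" and I: "finite I" "I \<noteq> {}"
  shows "cmod ((\<Prod>i\<in>I. z i) - (\<Prod>i\<in>I. w i)) \<le> card I * y * K ^ (card I - 1)"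
proof -
  have prod: "(\<Prod>i\<in>I. f i) = complex_of_real K ^ card I * (\<Prod>i\<in>I. f i / K)" for f :: "'i \<Rightarrow> complex"
    using K by (simp add: prod_dividef)
  have "cmod ((\<Prod>i\<in>I. z i / K) - (\<Prod>i\<in>I. w i / K)) \<le> (\<Sum>i\<in>I. cmod (z i / K - w i / K))"
    using K z w by (intro norm_prod_diff) (auto simp: norm_divide)
  also have "\<dots> \<le> (\<Sum>i\<in>I. y / K)"
    using K y by (intro sum_mono) (auto simp: norm_divide divide_right_mono simp flip: diff_divide_distrib)
  also have "\<dots> = card I * (y / K)" by simp
  finally have *: "cmod ((\<Prod>i\<in>I. z i / K) - (\<Prod>i\<in>I. w i / K)) \<le> card I * (y / K)" .
  have "card I > 0" using I by (simp add: card_gt_0_iff)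
  then have KK: "K ^ card I = K * K ^ (card I - 1)"
    by (simp add: power_eq_if)
  have "cmod ((\<Prod>i\<in>I. z i) - (\<Prod>i\<in>I. w i))
      = K ^ card I * cmod ((\<Prod>i\<in>I. z i / K) - (\<Prod>i\<in>I. w i / K))"
    unfolding prod[of z] prod[of w] using K
    by (simp add: norm_mult norm_power flip: right_diff_distrib)
  also have "\<dots> \<le> K ^ card I * (card I * (y / K))"
    using K * by (intro mult_left_mono) auto
  also have "\<dots> = card I * y * K ^ (card I - 1)"
    using K by (simp add: KK)
  finally show ?thesis .
qed

section \<open>The lower bound 2 for the constant M_n\<close>

lemma fact_le_two_mult_power: "fact (m + 2) \<le> 2 * (real m + 2) ^ m"
proof (induction m)
  case (Suc m)
  have "fact (Suc m + 2) = (real m + 3) * fact (m + 2)" by simp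
  also have "\<dots> \<le> (real m + 3) * (2 * (real m + 2) ^ m)"
    using Suc by (intro mult_left_mono) auto
  also have "\<dots> \<le> (real m + 3) * (2 * (real m + 3) ^ m)"
    by (intro mult_left_mono power_mono) auto
  finally show ?case by (simp add: algebra_simps)
qed simp

text \<open>Treats the fourth term of M_n for n = 2k and n = 2k + 1 at once, with r = n and with x
  and y its last two bases. Replacing x by r/2 and y by r gives the right side, written so that the
  small quotient r/2^k stands alone.\<close>

lemma M_const_subtrahend_le:
  assumes k: "k \<ge> 2" and r: "2 * real k \<le> r" and xy: "0 \<le> x" "x \<le> r / 2" "0 \<le> y" "y \<le> r"
  shows "r ^ (k - 2) * x ^ (k + 1) * y \<le> r ^ (2 * k - 1) / 2 * (r / 2 ^ k)"
proof -
  have "r ^ (k - 2) * x ^ (k + 1) * y \<le> r ^ (k - 2) * (r / 2) ^ (k + 1) * r"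
    using assms by (intro mult_mono power_mono) auto
  also have "\<dots> = r ^ (k - 2 + (k + 1) + 1) / 2 ^ (k + 1)"
    by (simp add: power_add power_divide)
  also have "k - 2 + (k + 1) + 1 = 2 * k - 1 + 1" using k by simp
  finally show ?thesis by (simp add: power_add field_simps)
qed

lemma two_mult_le_power_two: "k \<ge> 2 \<Longrightarrow> 2 * real k \<le> 2 ^ k"
  by (induction k rule: dec_induct) auto

text \<open>With the fourth term at most n^(n-1)/2, all main terms are compared with n^(n-2). What
  remains is at least (n^2 - (n-1)^2 - 2 - n/2) n^(n-2) - 1 = (3n/2 - 3) n^(n-2) - 1, and the
  coefficient is at least 3 for n > 3.\<close>

lemma M_const_ge_2:
  assumes n: "n > 3"
  shows "M_const n \<ge> 2"
proof -
  let ?r = "real n"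
  obtain T where M: "M_const n = ?r ^ n - (?r - 1) ^ n - fact n - T - 1"
    and T: "T \<le> ?r ^ (n - 1) / 2"
  proof (cases "even n")
    case True
    then obtain k where k: "n = 2 * k" by blast
    with n have k2: "k \<ge> 2" by simp
    have ex: "(n - 4) div 2 = k - 2" "(n + 2) div 2 = k + 1" "n - 1 = 2 * k - 1"
      using k by auto
    have "?r ^ (k - 2) * ((?r - 2) / 2) ^ (k + 1) * ((?r + 4) / 2) \<le> ?r ^ (2 * k - 1) / 2 * (?r / 2 ^ k)"
      using k2 n k by (intro M_const_subtrahend_le) auto
    also have "\<dots> \<le> ?r ^ (2 * k - 1) / 2 * 1"
      using two_mult_le_power_two[OF k2] k by (intro mult_left_mono) auto
    finally show ?thesis
      using True by (intro that[of "?r ^ (k - 2) * ((?r - 2) / 2) ^ (k + 1) * ((?r + 4) / 2)"])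
        (simp_all only: M_const_def ex if_True mult_1_right)
  next
    case False
    then obtain k where k: "n = 2 * k + 1" by (metis oddE)
    with n have k2: "k \<ge> 2" by simp
    have ex: "(n - 5) div 2 = k - 2" "(n + 1) div 2 = k + 1"
      using k by auto
    have "?r ^ (k - 2) * ((?r - 1) / 2) ^ (k + 1) * ((?r + 3) / 2) \<le> ?r ^ (2 * k - 1) / 2 * (?r / 2 ^ k)"
      using k2 n k by (intro M_const_subtrahend_le) auto
    \<comment> \<open>For odd n the exponent 2k - 1 is only n - 2, so a whole factor n is to spare
      and 2^k >= 1 suffices.\<close>
    also have "\<dots> \<le> ?r ^ (2 * k - 1) / 2 * ?r"
      using k by (intro mult_left_mono) (auto simp: divide_le_eq)
    also have "\<dots> = ?r ^ (n - 1) / 2"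
      using k k2 by (simp add: power_eq_if[of _ "2 * k"])
    finally show ?thesis
      using False by (intro that[of "?r ^ (k - 2) * ((?r - 1) / 2) ^ (k + 1) * ((?r + 3) / 2)"])
        (simp_all only: M_const_def ex if_False)
  qed
  define m where "m = n - 2"
  have nm: "n = m + 2" "real m = ?r - 2" using n by (auto simp: m_def)
  have "(?r - 1) ^ n = (?r - 1)\<^sup>2 * (?r - 1) ^ m"
    by (simp add: nm(1) power_add power2_eq_square)
  also have "\<dots> \<le> (?r - 1)\<^sup>2 * ?r ^ m"
    using n by (intro mult_left_mono power_mono) auto
  finally have 1: "(?r - 1) ^ n \<le> (?r - 1)\<^sup>2 * ?r ^ m" .
  have 2: "fact n \<le> 2 * ?r ^ m"
    using fact_le_two_mult_power[of m] unfolding nm(2) nm(1)[symmetric] by simp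
  have 3: "?r ^ n = ?r\<^sup>2 * ?r ^ m" "?r ^ (n - 1) = ?r * ?r ^ m"
    using nm(1) by (simp_all add: power_add power2_eq_square)
  have "1 \<le> ?r ^ m" using n by (intro one_le_power) auto
  then have "3 * 1 \<le> (3 / 2 * ?r - 3) * ?r ^ m"
    using n by (intro mult_mono) auto
  also have "\<dots> = ?r\<^sup>2 * ?r ^ m - (?r - 1)\<^sup>2 * ?r ^ m - 2 * ?r ^ m - ?r * ?r ^ m / 2"
    by (simp add: power2_eq_square algebra_simps)
  finally show ?thesis using M T 1 2 3 by linarith
qed

text \<open>Applied with b = \<open>\<alpha>\<^sub>0\<^sup>2\<close>, s =
  \<open>\<alpha>\<^sup>2\<close> and e the square of \<open>eps_const\<close>. Since M >= 2 and n!
  >= 2n(n-1), the factor n(n-1)e is at most s / (6 b^(n-1)), hence at most b/6. The power then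
  exceeds b^(n-1) by a factor of at most exp(1/6) <= 3/2, and 3/2 times 1/6 is 1/4.\<close>

lemma perturbation_bound:
  fixes b e s M :: real
  assumes n: "n > 3" and b: "b > 0" and M: "M \<ge> 2" and s: "0 < s" "s \<le> b ^ n"
    and e: "0 \<le> e" "e \<le> s / b ^ (n - 1) * (2 / (3 * fact n * M))"
  shows "n * (real (n - 1) * e) * (b + real (n - 1) * e) ^ (n - 1) \<le> s / 4"
proof -
  define c :: real where "c = 1 / (3 * fact n)"
  define m where "m = n - 2"
  have m: "n = Suc (Suc m)" using n by (simp add: m_def)
  have "fact n = n * (n - 1) * (fact (n - 2) :: nat)"
    by (simp add: m algebra_simps)
  moreover have "2 \<le> (fact (n - 2) :: nat)"
    using fact_ge_self[of "n - 2"] n by linarith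
  ultimately have "n * (n - 1) * 2 \<le> (fact n :: nat)"
    using mult_le_mono2[of 2 "fact (n - 2)" "n * (n - 1)"] by linarith
  then have "real (n * (n - 1) * 2) \<le> real (fact n)"
    by (rule of_nat_mono)
  then have fact: "real n * real (n - 1) * 2 \<le> fact n"
    by simp
  have "s / b ^ (n - 1) * (2 / (3 * fact n * M)) \<le> s / b ^ (n - 1) * c"
    using M s b by (intro mult_left_mono) (auto simp: c_def field_simps)
  then have e': "e \<le> s / b ^ (n - 1) * c" using e by linarith
  have "n * ((n - 1) * e) \<le> n * ((n - 1) * (s / b ^ (n - 1) * c))"
    using e' by (intro mult_left_mono) auto
  also have "\<dots> = (real n * real (n - 1) * 2) / fact n * (s / b ^ (n - 1)) / 6"
    by (simp add: c_def field_simps)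
  also have "\<dots> \<le> 1 * (s / b ^ (n - 1)) / 6"
    using fact s b by (intro divide_right_mono mult_right_mono) auto
  finally have ny: "n * ((n - 1) * e) \<le> s / b ^ (n - 1) / 6" by simp
  have "s / b ^ (n - 1) \<le> b"
    using s b n by (simp add: pos_divide_le_eq power_eq_if[of _ n])
  then have "s / b ^ (n - 1) / 6 \<le> b / 6" by (rule divide_right_mono) simp
  with ny have "n * ((n - 1) * e) \<le> b / 6" by (rule order.trans)
  then have y: "(n - 1) * e \<le> b * (1 / (6 * real n))"
    using n by (simp add: field_simps)
  have "(1 + 1 / (6 * real n)) ^ (n - 1) \<le> exp (1 / (6 * real n)) ^ (n - 1)"
    by (intro power_mono exp_ge_add_one_self) auto
  also have "\<dots> = exp ((n - 1) * (1 / (6 * real n)))"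
    by (rule exp_of_nat_mult[symmetric])
  also have "\<dots> \<le> exp (1 / 6 :: real)"
    using n by (simp add: field_simps)
  also have "\<dots> \<le> 3 / 2"
    using exp_bound[of "1 / 6 :: real"] by (simp add: power2_eq_square)
  finally have root: "(1 + 1 / (6 * real n)) ^ (n - 1) \<le> 3 / 2" .
  have "(b + (n - 1) * e) ^ (n - 1) \<le> (b * (1 + 1 / (6 * real n))) ^ (n - 1)"
    using y b e by (intro power_mono) (auto simp: distrib_left)
  also have "\<dots> \<le> b ^ (n - 1) * (3 / 2)"
    unfolding power_mult_distrib using root b by (intro mult_left_mono) auto
  finally have "n * ((n - 1) * e) * (b + (n - 1) * e) ^ (n - 1)
      \<le> s / b ^ (n - 1) / 6 * (b ^ (n - 1) * (3 / 2))"
    using ny e s b by (intro mult_mono) auto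
  also have "\<dots> = s / 4" using b by simp
  finally show ?thesis .
qed

section \<open>Permanent dominance near a rank one matrix\<close>

text \<open>Conjugation turns X_{i g(i)} into X_{g(i) i}; reindexing the product by g(i) gives the
  diagonal product of the inverse permutation.\<close>

lemma cnj_prod_ent_permutes:
  assumes herm: "\<And>i j. i \<in> {1..n} \<Longrightarrow> j \<in> {1..n} \<Longrightarrow> ent X j i = cnj (ent X i j)"
    and g: "g permutes {1..n}"
  shows "cnj (\<Prod>i\<in>{1..n}. ent X i (g i)) = (\<Prod>i\<in>{1..n}. ent X i (inv' g i))"
proof -
  have "(\<Prod>i\<in>{1..n}. ent X i (inv' g i)) = (\<Prod>i\<in>{1..n}. ent X (g i) (inv' g (g i)))"
    by (rule prod.reindex_bij_betw[OF permutes_imp_bij[OF g], symmetric])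
  also have "\<dots> = (\<Prod>i\<in>{1..n}. cnj (ent X i (g i)))"
  proof (rule prod.cong)
    fix i assume i: "i \<in> {1..n}"
    then have "g i \<in> {1..n}" using permutes_in_image[OF g] by blast
    then show "ent X (g i) (inv' g (g i)) = cnj (ent X i (g i))"
      using herm[OF i] permutes_inverses(2)[OF g] by simp
  qed simp
  finally show ?thesis by simp
qed

lemma sym_group_inv:
  assumes "g \<in> carrier (sym_group n)"
  shows "inv\<^bsub>sym_group n\<^esub> g = inv' g"
proof (rule group.inv_equality[OF sym_group_is_group])
  show "inv' g \<otimes>\<^bsub>sym_group n\<^esub> g = \<one>\<^bsub>sym_group n\<^esub>"
    using assms by (simp add: sym_group_mult sym_group_one sym_group_carrier permutes_inv_o)
qed (use assms sym_group_inv_closed in auto)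

text \<open>Conjugation exchanges the terms of g and its inverse, so the sum is its own conjugate.
  As \<chi> need not be given by a representation here, the constant 1 yields the permanent
  too.\<close>

lemma gen_matrix_fun_real:
  assumes herm: "\<And>i j. i \<in> {1..n} \<Longrightarrow> j \<in> {1..n} \<Longrightarrow> ent X j i = cnj (ent X i j)"
    and G: "subgroup G (sym_group n)"
    and \<chi>: "\<And>g. g \<in> G \<Longrightarrow> \<chi> (inv' g) = cnj (\<chi> g)"
  shows "gen_matrix_fun n G \<chi> X \<in> \<real>"
proof -
  have perm: "g permutes {1..n}" if "g \<in> G" for g
    using subgroup.mem_carrier[OF G that] by (simp add: sym_group_carrier)
  have inv: "inv' g \<in> G" if "g \<in> G" for g
    using subgroup.m_inv_closed[OF G that] sym_group_inv subgroup.mem_carrier[OF G that] by metis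
  have invinv: "inv' (inv' g) = g" if "g \<in> G" for g
    using perm[OF that] by (simp add: permutes_inv_inv)
  have "cnj (gen_matrix_fun n G \<chi> X) = (\<Sum>g\<in>G. \<chi> (inv' g) * (\<Prod>i\<in>{1..n}. ent X i (inv' g i)))"
    unfolding gen_matrix_fun_def cnj_sum complex_cnj_mult
  proof (rule sum.cong)
    fix g assume g: "g \<in> G"
    show "cnj (\<chi> g) * cnj (\<Prod>i\<in>{1..n}. ent X i (g i))
        = \<chi> (inv' g) * (\<Prod>i\<in>{1..n}. ent X i (inv' g i))"
      using cnj_prod_ent_permutes[OF herm perm[OF g]] \<chi>[OF g] by simp
  qed simp
  also have "\<dots> = gen_matrix_fun n G \<chi> X"
    unfolding gen_matrix_fun_def
    by (rule sum.reindex_bij_witness[of _ inv' inv']) (auto simp: inv invinv)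
  finally show ?thesis
    by (simp add: Reals_cnj_iff)
qed

text \<open>Isolates what the inequality needs: hermitian symmetry and diagonal products close to
  one positive number. The tolerance s/4 is small enough because, in units of n! s, the competitors
  1/4 and 5/8 stay below the lower bound 3/4 for the permanent.\<close>

lemma satisfies_permanent_dominanceI:
  fixes s :: real
  assumes herm: "\<And>i j. i \<in> {1..n} \<Longrightarrow> j \<in> {1..n} \<Longrightarrow> ent X j i = cnj (ent X i j)"
    and s: "s > 0"
    and close: "\<And>\<sigma>. \<sigma> permutes {1..n} \<Longrightarrow> cmod ((\<Prod>i\<in>{1..n}. ent X i (\<sigma> i)) - s) \<le> s / 4"
  shows "satisfies_permanent_dominance n X"
  unfolding satisfies_permanent_dominance_def
proof (intro allI impI, elim conjE)
  fix G \<chi> assume G: "subgroup G (sym_group n)" and irr: "irreducible_character n G \<chi>"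
  interpret S: group "sym_group n" by (rule sym_group_is_group)
  let ?H = "sym_group n\<lparr>carrier := G\<rparr>"
  let ?S = "carrier (sym_group n)"
  define p where "p g = (\<Prod>i\<in>{1..n}. ent X i (g i))" for g
  have H: "group ?H"
    using subgroup.subgroup_is_group[OF G sym_group_is_group] .
  have finS: "finite ?S"
    using card_ge_0_finite[of ?S] by (simp add: sym_group_card_carrier)
  have GS: "G \<subseteq> ?S" using subgroup.subset[OF G] .
  have finG: "finite G" using finite_subset[OF GS finS] .
  have p: "cmod (p g - s) \<le> s / 4" if "g \<in> ?S" for g
    using close that by (simp add: p_def sym_group_carrier)
  obtain d \<rho> where rep: "irreducible_representation n G d \<rho>" and \<chi>: "\<And>g. g \<in> G \<Longrightarrow> \<chi> g = mat_trace (\<rho> g)"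
    using irr by (auto simp: irreducible_character_def)
  have d: "d > 0" and hom: "\<rho> \<in> hom ?H (units_of (ring_mat TYPE(complex) d ()))"
    using rep by (auto simp: irreducible_representation_def representation_def)
  note \<rho> = representation_matrices[OF H hom, simplified]
  note char = character_values[OF H _ hom, simplified, OF finG]
  have trace_one: "mat_trace (1\<^sub>m d) = d" by (simp add: mat_trace_def)
  have \<chi>1: "\<chi> \<one>\<^bsub>sym_group n\<^esub> = d"
    using \<chi>[OF subgroup.one_closed[OF G]] \<rho>(3) trace_one by simp
  have "\<chi> (inv' g) = cnj (\<chi> g)" if g: "g \<in> G" for g
  proof -
    have inv: "inv\<^bsub>?H\<^esub> g = inv' g"
      using S.m_inv_consistent[OF G g] sym_group_inv GS g by auto
    have "inv' g \<in> G"
      using subgroup.m_inv_closed[OF G g] sym_group_inv GS g by auto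
    then show ?thesis
      using char(2)[OF g] \<chi> g inv by simp
  qed
  then have "gen_matrix_fun n G \<chi> X \<in> \<real>"
    using gen_matrix_fun_real herm G by blast
  then have real1: "norm_gen_matrix_fun n G \<chi> X \<in> \<real>"
    unfolding norm_gen_matrix_fun_def \<chi>1 by (intro Reals_divide) auto
  have per: "per n X = (\<Sum>g\<in>?S. p g)"
    by (simp add: per_def p_def)
  have "gen_matrix_fun n ?S (\<lambda>_. 1) X \<in> \<real>"
    using gen_matrix_fun_real[OF herm S.subgroup_self] by simp
  then have real2: "per n X \<in> \<real>"
    by (simp add: gen_matrix_fun_def per_def)
  have "Re (p g) \<ge> 3 / 4 * s" if "g \<in> ?S" for g
  proof -
    have "\<bar>Re (p g) - s\<bar> \<le> s / 4"
      using order.trans[OF abs_Re_le_cmod p[OF that]] by simp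
    then show ?thesis by linarith
  qed
  then have "(\<Sum>g\<in>?S. 3 / 4 * s) \<le> Re (per n X)"
    unfolding per Re_sum by (intro sum_mono)
  then have per_ge: "fact n * (3 / 4 * s) \<le> Re (per n X)"
    by (simp add: sym_group_card_carrier)
  have norm: "norm_gen_matrix_fun n G \<chi> X = (\<Sum>g\<in>G. \<chi> g * p g) / d"
    by (simp add: norm_gen_matrix_fun_def gen_matrix_fun_def p_def \<chi>1)
  have "real (card G) \<le> real (fact n)"
    using card_mono[OF finS GS] by (simp only: sym_group_card_carrier of_nat_le_iff)
  then have cardG: "card G \<le> (fact n :: real)" by simp
  have "Re (norm_gen_matrix_fun n G \<chi> X) \<le> Re (per n X)"
    using irreducible_character_sum[OF G rep]
  proof
    \<comment> \<open>Subtracting s from each diagonal product changes nothing, and the bound d on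
      the character values cancels against the division by \<chi>(e) = d.\<close>
    assume "(\<Sum>g\<in>G. mat_trace (\<rho> g)) = 0"
    then have "(\<Sum>g\<in>G. \<chi> g) = 0" using \<chi> by simp
    then have "(\<Sum>g\<in>G. \<chi> g * p g) = (\<Sum>g\<in>G. \<chi> g * (p g - s))"
      by (simp add: right_diff_distrib sum_subtractf flip: sum_distrib_right)
    also have "cmod \<dots> \<le> (\<Sum>g\<in>G. d * (s / 4))"
    proof (rule sum_norm_le)
      fix g assume g: "g \<in> G"
      show "cmod (\<chi> g * (p g - s)) \<le> d * (s / 4)"
        unfolding norm_mult using p[of g] g GS char(1)[OF g] \<chi>[OF g] by (intro mult_mono) auto
    qed
    finally have "cmod (norm_gen_matrix_fun n G \<chi> X) \<le> card G * (s / 4)"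
      using d by (simp add: norm norm_divide divide_le_eq mult_ac)
    also have "\<dots> \<le> fact n * (s / 4)"
      using cardG s by (intro mult_right_mono) auto
    also have "\<dots> \<le> fact n * (3 / 4 * s)"
      using s by (intro mult_left_mono) auto
    finally show ?thesis
      using per_ge complex_Re_le_cmod[of "norm_gen_matrix_fun n G \<chi> X"] by linarith
  next
    \<comment> \<open>The character is constantly d, and normalization removes d whatever its
      value.\<close>
    assume "\<forall>g\<in>G. \<rho> g = 1\<^sub>m d"
    then have "\<chi> g = d" if "g \<in> G" for g
      using \<chi>[OF that] that trace_one by simp
    then have norm': "norm_gen_matrix_fun n G \<chi> X = (\<Sum>g\<in>G. p g)"
      using d by (simp add: norm flip: sum_distrib_left)
    show ?thesis
    proof (cases "G = ?S")
      case True
      then show ?thesis using norm' per by simp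
    next
      case False
      have lagrange: "card (rcosets\<^bsub>sym_group n\<^esub> G) * card G = fact n"
        using S.lagrange[OF G] by (simp add: Coset.order_def sym_group_card_carrier)
      have "card G \<noteq> fact n"
        using False card_subset_eq[OF finS GS] sym_group_card_carrier[of n] by metis
      \<comment> \<open>Index 0 would force n! = 0, and index 1 would make \<open>G\<close> as large
        as the whole symmetric group.\<close>
      have "card (rcosets\<^bsub>sym_group n\<^esub> G) \<ge> 2"
      proof (rule ccontr)
        assume "\<not> ?thesis"
        then have "card (rcosets\<^bsub>sym_group n\<^esub> G) = 0 \<or> card (rcosets\<^bsub>sym_group n\<^esub> G) = 1"
          by linarith
        with lagrange \<open>card G \<noteq> fact n\<close> show False by auto
      qed
      from mult_le_mono1[OF this, of "card G"] have "2 * card G \<le> fact n"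
        by (simp only: lagrange)
      then have "real (2 * card G) \<le> real (fact n)"
        by (rule of_nat_mono)
      then have "card G \<le> fact n / (2 :: real)"
        by simp
      have "Re (p g) \<le> 5 / 4 * s" if "g \<in> G" for g
      proof -
        have "\<bar>Re (p g) - s\<bar> \<le> s / 4"
          using order.trans[OF abs_Re_le_cmod p[of g]] GS that by auto
        then show ?thesis by linarith
      qed
      then have "Re (norm_gen_matrix_fun n G \<chi> X) \<le> (\<Sum>g\<in>G. 5 / 4 * s)"
        unfolding norm' Re_sum by (intro sum_mono)
      also have "\<dots> = card G * (5 / 4 * s)" by simp
      also have "\<dots> \<le> fact n / 2 * (5 / 4 * s)"
        using \<open>card G \<le> fact n / (2 :: real)\<close> s by (intro mult_right_mono) auto
      also have "\<dots> \<le> fact n * (3 / 4 * s)"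
        using s by (simp add: field_simps)
      finally show ?thesis using per_ge by linarith
    qed
  qed
  with real1 real2 show "norm_gen_matrix_fun n G \<chi> X \<in> \<real> \<and> per n X \<in> \<real> \<and>
      Re (norm_gen_matrix_fun n G \<chi> X) \<le> Re (per n X)"
    by blast
qed

section \<open>Congruences of diagonal matrices\<close>

lemma mat_adjoint_index:
  assumes "A \<in> carrier_mat n k" "i < k" "j < n"
  shows "mat_adjoint A $$ (i, j) = cnj (A $$ (j, i))"
  using assms by (simp add: mat_adjoint_def mat_of_rows_def)

lemma mat_adjoint_carrier:
  assumes "A \<in> carrier_mat n k"
  shows "mat_adjoint (A :: complex mat) \<in> carrier_mat k n"
  using assms by (auto simp: mat_adjoint_def)

text \<open>With general real diagonal values \<open>f\<close> the following facts serve both the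
  members of the class and, for \<open>f\<close> constantly 1, the matrix L L* itself.\<close>

context
  fixes n :: nat and L :: "complex mat" and f :: "nat \<Rightarrow> real" and X :: "complex mat"
  assumes L: "L \<in> carrier_mat n n"
    and X: "X = L * mat_diag n (\<lambda>k. complex_of_real (f k)) * mat_adjoint L"
begin

lemma diag_congruence_carrier: "X \<in> carrier_mat n n"
  unfolding X using L mat_adjoint_carrier[OF L] by auto

lemma diag_congruence_index:
  assumes "i < n" "j < n"
  shows "X $$ (i, j) = (\<Sum>k<n. f k * L $$ (i, k) * cnj (L $$ (j, k)))"
proof -
  have "L * mat_diag n (\<lambda>k. complex_of_real (f k)) = mat n n (\<lambda>(i, j). L $$ (i, j) * f j)"
    by (rule mat_diag_mult_right[OF L])
  then show ?thesis
    unfolding X using L mat_adjoint_carrier[OF L] mat_adjoint_index[OF L] assms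
    by (auto simp: scalar_prod_def atLeast0LessThan intro!: sum.cong)
qed

text \<open>\<open>ent\<close> counts from 1 while \<open>f\<close> keeps the positions 0 to n - 1
  of \<open>mat_diag\<close>, hence the argument \<open>k - 1\<close>.\<close>

lemma diag_congruence_ent:
  assumes "i \<in> {1..n}" "j \<in> {1..n}"
  shows "ent X i j = (\<Sum>k\<in>{1..n}. f (k - 1) * ent L i k * cnj (ent L j k))"
proof -
  have "ent X i j = (\<Sum>k<n. f k * L $$ (i - 1, k) * cnj (L $$ (j - 1, k)))"
    unfolding ent_def using assms by (intro diag_congruence_index) auto
  also have "\<dots> = (\<Sum>k\<in>{1..n}. f (k - 1) * ent L i k * cnj (ent L j k))"
    by (rule sum.reindex_bij_witness[of _ "\<lambda>k. k - 1" Suc]) (auto simp: ent_def)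
  finally show ?thesis .
qed

lemma diag_congruence_hermitian:
  assumes "i < n" "j < n"
  shows "X $$ (j, i) = cnj (X $$ (i, j))"
  by (simp add: diag_congruence_index assms mult_ac)

text \<open>The quadratic form at v is the sum of f_k |u_k|^2, where u_k is the conjugate of
  coordinate k of L* v.\<close>

lemma diag_congruence_pos_semidef:
  assumes f: "\<And>k. k < n \<Longrightarrow> 0 \<le> f k"
  shows "pos_semidef n X"
  unfolding pos_semidef_def
proof (intro conjI ballI)
  note c = diag_congruence_carrier
  show "X \<in> carrier_mat n n" by (rule c)
  show "mat_adjoint X = X"
    using c mat_adjoint_carrier[OF c]
    by (intro eq_matI) (auto simp: mat_adjoint_index[OF c] diag_congruence_hermitian[symmetric])
  fix v :: "complex vec" assume v: "v \<in> carrier_vec n"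
  define u where "u k = (\<Sum>i<n. L $$ (i, k) * cnj (v $ i))" for k
  have "(X *\<^sub>v v) \<bullet>c v = (\<Sum>i<n. \<Sum>j<n. X $$ (i, j) * v $ j * cnj (v $ i))"
    using v c by (auto simp: scalar_prod_def atLeast0LessThan sum_distrib_right intro!: sum.cong)
  also have "\<dots> = (\<Sum>i<n. \<Sum>j<n. \<Sum>k<n. f k * ((L $$ (i, k) * cnj (v $ i)) * cnj (L $$ (j, k) * cnj (v $ j))))"
    by (intro sum.cong refl) (simp add: diag_congruence_index sum_distrib_left sum_distrib_right mult_ac)
  also have "\<dots> = (\<Sum>k<n. \<Sum>i<n. \<Sum>j<n. f k * ((L $$ (i, k) * cnj (v $ i)) * cnj (L $$ (j, k) * cnj (v $ j))))"
    by (subst (2) sum.swap, subst sum.swap) simp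
  also have "\<dots> = (\<Sum>k<n. f k * (u k * cnj (u k)))"
    unfolding u_def cnj_sum sum_product by (simp add: sum_distrib_left)
  also have "\<dots> = complex_of_real (\<Sum>k<n. f k * (cmod (u k))\<^sup>2)"
    by (simp only: of_real_sum of_real_mult complex_norm_square)
  finally have *: "(X *\<^sub>v v) \<bullet>c v = complex_of_real (\<Sum>k<n. f k * (cmod (u k))\<^sup>2)" .
  show "(X *\<^sub>v v) \<bullet>c v \<in> \<real>" unfolding * by (rule Reals_of_real)
  show "0 \<le> Re ((X *\<^sub>v v) \<bullet>c v)"
    unfolding * Re_complex_of_real using f by (intro sum_nonneg mult_nonneg_nonneg) auto
qed

end

text \<open>Pulls the coercion out of the conditional, so that the diagonal has the shape required
  by the facts on congruences.\<close>

lemma matrix_class_eq: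
  "matrix_class n L a =
    {L * mat_diag n (\<lambda>k. complex_of_real (if k = 0 then 1 else (lam (k + 1))\<^sup>2)) * mat_adjoint L
      | lam. \<forall>j\<in>{2..n}. 0 < lam j \<and> lam j \<le> a}"
proof -
  have "(\<lambda>k. if k = 0 then 1 else complex_of_real ((lam (k + 1))\<^sup>2))
      = (\<lambda>k. complex_of_real (if k = 0 then 1 else (lam (k + 1))\<^sup>2))" for lam :: "nat \<Rightarrow> real"
    by auto
  then show ?thesis unfolding matrix_class_def by simp
qed

text \<open>Only \<lambda>_j = t varies in (0, a], all other parameters being a. The diagonal entry
  (i, i) is t^2 |L_ij|^2 plus a constant, which is injective in t > 0.\<close>

lemma infinite_matrix_class:
  assumes L: "L \<in> carrier_mat n n" and a: "a > 0"
    and ij: "i \<in> {2..n}" "j \<in> {2..n}" and nz: "ent L i j \<noteq> 0"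
  shows "infinite (matrix_class n L a)"
proof -
  define f where "f t k = (if k = 0 then 1 else (if k + 1 = j then t else a)\<^sup>2)" for t k
  define X where "X t = L * mat_diag n (\<lambda>k. complex_of_real (f t k)) * mat_adjoint L" for t
  have X_mem: "X t \<in> matrix_class n L a" if "t \<in> {0<..a}" for t
    unfolding matrix_class_eq X_def f_def using a that
    by (intro CollectI exI[of _ "\<lambda>k. if k = j then t else a"]) auto
  have "inj_on X {0<..a}"
  proof (rule inj_onI)
    fix s t assume st: "s \<in> {0<..a}" "t \<in> {0<..a}" and eq: "X s = X t"
    \<comment> \<open>Away from k = j the values of \<open>f\<close> do not depend on the varying
      parameter; a merely fills its place.\<close>
    define R where "R = (\<Sum>k\<in>{1..n} - {j}. f a (k - 1) * ent L i k * cnj (ent L i k))"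
    have entry: "ent (X t) i i = t\<^sup>2 * (ent L i j * cnj (ent L i j)) + R" for t
    proof -
      have "ent (X t) i i = (\<Sum>k\<in>{1..n}. f t (k - 1) * ent L i k * cnj (ent L i k))"
        using ij by (intro diag_congruence_ent[OF L X_def]) auto
      also have "\<dots> = f t (j - 1) * ent L i j * cnj (ent L i j)
          + (\<Sum>k\<in>{1..n} - {j}. f t (k - 1) * ent L i k * cnj (ent L i k))"
        using ij by (intro sum.remove) auto
      also have "(\<Sum>k\<in>{1..n} - {j}. f t (k - 1) * ent L i k * cnj (ent L i k)) = R"
        unfolding R_def f_def by (intro sum.cong) auto
      also have "f t (j - 1) = t\<^sup>2" using ij by (simp add: f_def)
      finally show ?thesis by simp
    qed
    have "complex_of_real (s\<^sup>2) = complex_of_real (t\<^sup>2)"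
      using arg_cong[OF eq, of "\<lambda>Y. ent Y i i"] nz unfolding entry by simp
    then have "s\<^sup>2 = t\<^sup>2" by (simp only: of_real_eq_iff)
    then show "s = t" using st by (simp add: power2_eq_iff_nonneg)
  qed
  moreover have "infinite {0<..a}" using a by (rule infinite_Ioc)
  ultimately have "infinite (X ` {0<..a})" by (simp add: finite_image_iff)
  moreover have "X ` {0<..a} \<subseteq> matrix_class n L a" using X_mem by blast
  ultimately show ?thesis using infinite_super by blast
qed

section \<open>Assembling the estimates for the matrix class\<close>

theorem theorem3p8:
  fixes n :: nat and A L :: "complex mat" and m a \<alpha> \<alpha>\<^sub>0 :: real
  assumes "n > 3"
    and "L \<in> carrier_mat n n"
    and "lower_triangular n L"
    and "A = L * mat_adjoint L"
    and "m = Max {cmod (ent L i j) | i j. i \<in> {2..n} \<and> j \<in> {2..n}}"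
    and "m \<noteq> 0"
    and "\<alpha> = (\<Prod>i\<in>{1..n}. cmod (ent L i 1))"
    and "\<alpha>\<^sub>0 = Max {cmod (ent L i 1) | i. i \<in> {1..n}}"
    and "a = eps_const n \<alpha> \<alpha>\<^sub>0 / m"
    and "\<forall>i\<in>{1..n}. ent A i 1 \<noteq> 0"
  shows "infinite (matrix_class n L a) \<and>
    (\<forall>X\<in>matrix_class n L a. pos_semidef n X \<and> satisfies_permanent_dominance n X)"
proof -
  note n = assms(1) and L = assms(2)
  let ?v = "\<lambda>i. ent L i 1"
  let ?S = "{cmod (ent L i j) | i j. i \<in> {2..n} \<and> j \<in> {2..n}}"
  let ?T = "{cmod (ent L i 1) | i. i \<in> {1..n}}"
  have "?S = (\<lambda>(i, j). cmod (ent L i j)) ` ({2..n} \<times> {2..n})" by fast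
  then have finS: "finite ?S" by simp
  have "cmod (ent L 2 2) \<in> ?S" using n by force
  then have "m \<in> ?S" unfolding assms(5) using finS by (intro Max_in) auto
  then obtain i0 j0 where ij0: "i0 \<in> {2..n}" "j0 \<in> {2..n}" "m = cmod (ent L i0 j0)" by blast
  \<comment> \<open>A nonzero maximum makes the division defining \<open>a\<close> meaningful and
    supplies the entry from which infinitude follows.\<close>
  with assms(6) have m: "m > 0" and nz: "ent L i0 j0 \<noteq> 0" by auto
  \<comment> \<open>The maximum omits row 1, but there triangularity makes the entries in columns 2
    to n zero.\<close>
  have L_le: "cmod (ent L i k) \<le> m" if "i \<in> {1..n}" "k \<in> {2..n}" for i k
  proof (cases "i = 1")
    case True
    then show ?thesis
      using assms(3) that m n unfolding lower_triangular_def by auto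
  next
    case False
    then have "cmod (ent L i k) \<in> ?S" using that by force
    then show ?thesis unfolding assms(5) by (rule Max_ge[OF finS])
  qed
  have "?T = (\<lambda>i. cmod (ent L i 1)) ` {1..n}" by auto
  then have finT: "finite ?T" by simp
  have v_le: "cmod (?v i) \<le> \<alpha>\<^sub>0" if "i \<in> {1..n}" for i
    unfolding assms(8) using that by (intro Max_ge[OF finT]) blast
  \<comment> \<open>Row 1 of L has only its first entry, so A_{i1} is L_{i1} times the conjugate of
    L_11.\<close>
  have v_nz: "?v i \<noteq> 0" if i: "i \<in> {1..n}" for i
  proof
    assume zero: "?v i = 0"
    have "A = L * mat_diag n (\<lambda>k. complex_of_real 1) * mat_adjoint L"
      using L by (simp add: assms(4))
    from diag_congruence_ent[OF L this i, of 1]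
    have "ent A i 1 = (\<Sum>k\<in>{1..n}. ent L i k * cnj (ent L 1 k))" using n by simp
    also have "\<dots> = 0"
    proof (rule sum.neutral, safe)
      fix k assume k: "k \<in> {1..n}"
      show "ent L i k * cnj (ent L 1 k) = 0"
        using zero assms(3) k n unfolding lower_triangular_def by (cases "k = 1") auto
    qed
    finally show False using assms(10) i by blast
  qed
  have \<alpha>: "\<alpha> > 0" unfolding assms(7) using v_nz by (intro prod_pos) auto
  have "0 < cmod (?v 1)" using v_nz[of 1] n by simp
  also have "cmod (?v 1) \<le> \<alpha>\<^sub>0" by (rule v_le) (use n in simp)
  finally have \<alpha>0: "\<alpha>\<^sub>0 > 0" .
  have M: "M_const n \<ge> 2" using M_const_ge_2[OF n] .
  \<comment> \<open>b bounds the entries of v v*, each a product of two first-column entries; s will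
    be the common value of its diagonal products.\<close>
  define b where "b = \<alpha>\<^sub>0\<^sup>2"
  define s where "s = \<alpha>\<^sup>2"
  define \<epsilon> where "\<epsilon> = eps_const n \<alpha> \<alpha>\<^sub>0"
  have \<epsilon>: "\<epsilon> > 0"
    unfolding \<epsilon>_def eps_const_def using \<alpha> \<alpha>0 M by auto
  have b: "b > 0" and s: "s > 0" using \<alpha> \<alpha>0 by (auto simp: b_def s_def)
  have "\<alpha> \<le> (\<Prod>i\<in>{1..n}. \<alpha>\<^sub>0)"
    unfolding assms(7) using v_le by (intro prod_mono) auto
  then have "\<alpha>\<^sup>2 \<le> (\<alpha>\<^sub>0 ^ n)\<^sup>2"
    using \<alpha> by (intro power_mono) auto
  then have sb: "s \<le> b ^ n"
    by (simp add: s_def b_def power_mult[symmetric] mult.commute)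
  have "\<epsilon> \<le> \<alpha> / \<alpha>\<^sub>0 ^ (n - 1) * sqrt (2 / (3 * fact n * M_const n))"
    by (simp add: \<epsilon>_def eps_const_def)
  then have "\<epsilon>\<^sup>2 \<le> (\<alpha> / \<alpha>\<^sub>0 ^ (n - 1) * sqrt (2 / (3 * fact n * M_const n)))\<^sup>2"
    using \<epsilon> by (intro power_mono) auto
  also have "\<dots> = s / b ^ (n - 1) * (2 / (3 * fact n * M_const n))"
    using M by (simp add: s_def b_def power_mult_distrib power_divide power_mult[symmetric] mult.commute)
  finally have eps2: "\<epsilon>\<^sup>2 \<le> s / b ^ (n - 1) * (2 / (3 * fact n * M_const n))" .
  \<comment> \<open>Each of the columns 2 to n contributes at most (a m)^2 =
    \<open>\<epsilon>\<^sup>2\<close> to an entry of X - v v*.\<close>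
  define y where "y = real (n - 1) * \<epsilon>\<^sup>2"
  have bound: "n * y * (b + y) ^ (n - 1) \<le> s / 4"
    unfolding y_def by (rule perturbation_bound[OF n b M s sb _ eps2]) simp
  have y: "y \<ge> 0" by (simp add: y_def)
  have a: "a > 0" using \<epsilon> m by (simp add: assms(9) \<epsilon>_def)
  have "pos_semidef n X \<and> satisfies_permanent_dominance n X" if mem: "X \<in> matrix_class n L a" for X
  proof -
    obtain lam where lam: "\<And>j. j \<in> {2..n} \<Longrightarrow> 0 < lam j \<and> lam j \<le> a"
      and X': "X = L * mat_diag n (\<lambda>k. complex_of_real (if k = 0 then 1 else (lam (k + 1))\<^sup>2)) * mat_adjoint L"
      using mem unfolding matrix_class_eq by blast
    define f where f: "f k = (if k = 0 then 1 else (lam (k + 1))\<^sup>2)" for k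
    have X: "X = L * mat_diag n (\<lambda>k. complex_of_real (f k)) * mat_adjoint L"
      using X' by (simp only: f)
    have diff: "cmod (ent X i j - ?v i * cnj (?v j)) \<le> y" if ij: "i \<in> {1..n}" "j \<in> {1..n}" for i j
    proof -
      \<comment> \<open>The term k = 1 has weight \<open>f 0 = 1\<close> and is exactly the entry of
        v v*.\<close>
      have "{1..n} = insert 1 {2..n}" using n by auto
      then have "ent X i j - ?v i * cnj (?v j) = (\<Sum>k\<in>{2..n}. f (k - 1) * ent L i k * cnj (ent L j k))"
        using diag_congruence_ent[OF L X ij] by (simp add: f)
      also have "cmod \<dots> \<le> (\<Sum>k\<in>{2..n}. \<epsilon>\<^sup>2)"
      proof (rule sum_norm_le)
        fix k assume k: "k \<in> {2..n}"
        have "f (k - 1) = (lam k)\<^sup>2" using k by (auto simp: f)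
        then have "cmod (f (k - 1) * ent L i k * cnj (ent L j k))
            = (lam k)\<^sup>2 * cmod (ent L i k) * cmod (ent L j k)"
          by (simp add: norm_mult norm_power)
        also have "\<dots> \<le> a\<^sup>2 * m * m"
          using lam[OF k] L_le[OF ij(1) k] L_le[OF ij(2) k] m
          by (intro mult_mono power_mono) auto
        also have "\<dots> = \<epsilon>\<^sup>2"
          using m by (simp add: assms(9) \<epsilon>_def power2_eq_square)
        finally show "cmod (f (k - 1) * ent L i k * cnj (ent L j k)) \<le> \<epsilon>\<^sup>2" .
      qed
      also have "\<dots> = y" using n by (simp add: y_def)
      finally show ?thesis .
    qed
    have vv: "cmod (?v i * cnj (?v j)) \<le> b" if "i \<in> {1..n}" "j \<in> {1..n}" for i j
      using v_le[OF that(1)] v_le[OF that(2)] \<alpha>0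
      by (auto simp: norm_mult b_def power2_eq_square intro!: mult_mono)
    have close: "cmod ((\<Prod>i\<in>{1..n}. ent X i (\<sigma> i)) - s) \<le> s / 4" if \<sigma>: "\<sigma> permutes {1..n}" for \<sigma>
    proof -
      have in_range: "\<sigma> i \<in> {1..n}" if "i \<in> {1..n}" for i
        using permutes_in_image[OF \<sigma>] that by blast
      \<comment> \<open>A permutation merely reorders the conjugated factors, so every diagonal
        product of v v* is |v_1 ... v_n|^2 = s.\<close>
      have "(\<Prod>i\<in>{1..n}. cnj (?v (\<sigma> i))) = cnj (\<Prod>i\<in>{1..n}. ?v i)"
        using prod.reindex_bij_betw[OF permutes_imp_bij[OF \<sigma>], of "\<lambda>i. cnj (?v i)"] by simp
      then have s_eq: "(\<Prod>i\<in>{1..n}. ?v i * cnj (?v (\<sigma> i))) = s"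
        by (simp only: prod.distrib s_def assms(7) prod_norm complex_norm_square)
      have "cmod ((\<Prod>i\<in>{1..n}. ent X i (\<sigma> i)) - (\<Prod>i\<in>{1..n}. ?v i * cnj (?v (\<sigma> i))))
          \<le> card {1..n} * y * (b + y) ^ (card {1..n} - 1)"
      proof (rule norm_prod_diff_le)
        fix i assume i: "i \<in> {1..n}"
        note * = diff[OF i in_range[OF i]] vv[OF i in_range[OF i]]
        then show "cmod (ent X i (\<sigma> i)) \<le> b + y"
          using norm_triangle_sub[of "ent X i (\<sigma> i)" "?v i * cnj (?v (\<sigma> i))"] by linarith
        show "cmod (?v i * cnj (?v (\<sigma> i))) \<le> b + y" using * y by linarith
        show "cmod (ent X i (\<sigma> i) - ?v i * cnj (?v (\<sigma> i))) \<le> y" by (rule *)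
      qed (use b y n in auto)
      then show ?thesis
        unfolding s_eq card_atLeastAtMost diff_Suc_1 using bound by linarith
    qed
    have "ent X j i = cnj (ent X i j)" if "i \<in> {1..n}" "j \<in> {1..n}" for i j
      unfolding ent_def using that by (intro diag_congruence_hermitian[OF L X]) auto
    then have "satisfies_permanent_dominance n X"
      using satisfies_permanent_dominanceI[OF _ s close] by blast
    moreover have "pos_semidef n X"
      by (rule diag_congruence_pos_semidef[OF L X]) (simp add: f)
    ultimately show ?thesis by blast
  qed
  then show ?thesis
    using infinite_matrix_class[OF L a ij0(1,2) nz] by blast
qed

end
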